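(* Let $0<|q|<1$. With $a_n=-(1+q)q^{2n-1}$ and $b_n^2=q^{4n-3}$, for every $z\neq0$ for which the denominator on the right is nonzero, $$\cfrac{1}{z+(1+q)q^{-1}-\cfrac{q}{z+(1+q)q-\cfrac{q^5}{z+(1+q)q^3-\cdots}}}=\frac1z\;\frac{\displaystyle\sum_{n=0}^\infty\frac{q^{n^2}}{(q)_n}z^{-n}}{\displaystyle\sum_{n=0}^\infty\frac{q^{n^2-2n}}{(q)_n}z^{-n}},$$ where the continued fraction on the left is $\cfrac{1}{z-a_0-\cfrac{b_1^2}{z-a_1-\cfrac{b_2^2}{z-a_2-\cdots}}}$.
   Context: Here $(q)_n=\prod_{j=1}^n(1-q^j)$. *)

theory Defs
  imports "HOL-Analysis.Analysis"
begin

definition q_poch :: "complex \<Rightarrow> nat \<Rightarrow> complex" where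
  "q_poch q n = (\<Prod>j=1..n. 1 - q ^ j)"

text \<open>
  A finite continued fraction is evaluated in the Riemann sphere, represented by
  \<^typ>\<open>complex option\<close> with \<^const>\<open>None\<close> for the point at infinity. In this way an
  approximant is correct even if some inner denominator vanishes, which the convention
  \<open>x / 0 = 0\<close> would spoil. The map is \<open>w \<mapsto> c / (d + w)\<close>, meant for \<open>c \<noteq> 0\<close>.
\<close>

definition cf_step :: "complex \<Rightarrow> complex \<Rightarrow> complex option \<Rightarrow> complex option" where
  "cf_step c d w =
     (case w of
        None \<Rightarrow> Some 0
      | Some u \<Rightarrow> if d + u = 0 then None else Some (c / (d + u)))"

text \<open>
  \<open>cf_tail c d k n\<close> is the fraction
  \<open>c k / (d k + c (k+1) / (d (k+1) + \<dots> + c (k+n-1) / d (k+n-1)))\<close> with \<open>n\<close> levels.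
\<close>

primrec cf_tail ::
  "(nat \<Rightarrow> complex) \<Rightarrow> (nat \<Rightarrow> complex) \<Rightarrow> nat \<Rightarrow> nat \<Rightarrow> complex option" where
  "cf_tail c d k 0 = Some 0"
| "cf_tail c d k (Suc n) = cf_step (c k) (d k) (cf_tail c d (Suc k) n)"

text \<open>
  The infinite continued fraction has the finite value \<open>L\<close> if its approximants converge
  to \<open>L\<close> in the Riemann sphere; finitely many of them may be infinite.
\<close>

definition cf_has_value ::
  "(nat \<Rightarrow> complex) \<Rightarrow> (nat \<Rightarrow> complex) \<Rightarrow> complex \<Rightarrow> bool" where
  "cf_has_value c d L \<longleftrightarrow>
     (\<exists>v. (\<forall>\<^sub>F n in sequentially. cf_tail c d 0 n = Some (v n)) \<and> v \<longlonglongrightarrow> L)"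

text \<open>
  The J-fraction \<open>1 / (z - a 0 - (b 1)\<^sup>2 / (z - a 1 - (b 2)\<^sup>2 / (z - a 2 - \<dots>)))\<close>;
  the value \<open>b 0\<close> is not used.
\<close>

definition J_fraction_has_value ::
  "(nat \<Rightarrow> complex) \<Rightarrow> (nat \<Rightarrow> complex) \<Rightarrow> complex \<Rightarrow> complex \<Rightarrow> bool" where
  "J_fraction_has_value a b z L \<longleftrightarrow>
     cf_has_value (\<lambda>n. if n = 0 then 1 else - (b n)\<^sup>2) (\<lambda>n. z - a n) L"

end

(*
  The series F(w) = sum q^(n^2) w^n / (q)_n satisfies F(w) = F(qw) + q w F(q^2 w). Using this
  relation three times gives a three-term recurrence for H k = F(q^(2k-2)/z), the one
  of the J-fraction after rescaling by powers of z. Let Q k n be the denominator of the fraction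
  that starts at level k and has n levels. Expanding H k along the recurrence expresses it through
  Q k n and Q k (n-1), with coefficients H (k+n) (which tends to 1) and one that tends to 0; hence
  Q k n / z^n tends to H k. The n-th approximant is Q 1 (n-1) / Q 0 n.
*)
theory Submission
  imports Defs
begin

section \<open>Limits of J-fractions with vanishing coefficients\<close>

text \<open>Once \<open>norm (s n)\<close> is below 1/2 and \<open>r\<close> is bounded, the
  recurrence keeps \<open>v\<close> bounded; then \<open>s n * v n\<close> tends to 0 and
  \<open>v (Suc n)\<close> inherits the limit of \<open>r n\<close>.\<close>

lemma tendsto_affine_recurrence:
  fixes v r s :: "nat \<Rightarrow> complex"
  assumes rec: "\<forall>\<^sub>F n in sequentially. v (Suc n) = r n + s n * v n"
    and r: "r \<longlonglongrightarrow> C" and s: "s \<longlonglongrightarrow> 0"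
  shows "v \<longlonglongrightarrow> C"
proof -
  define M where "M = norm C + 1"
  have "\<forall>\<^sub>F n in sequentially. norm (r n) < M"
    using order_tendstoD(2)[OF tendsto_norm[OF r], of M] by (simp add: M_def)
  moreover have "\<forall>\<^sub>F n in sequentially. norm (s n) < 1/2"
    using order_tendstoD(2)[OF tendsto_norm[OF s], of "1/2"] by simp
  ultimately have "\<forall>\<^sub>F n in sequentially.
      v (Suc n) = r n + s n * v n \<and> norm (r n) < M \<and> norm (s n) < 1/2"
    using rec by eventually_elim auto
  then obtain N where N: "\<And>n. n \<ge> N \<Longrightarrow> v (Suc n) = r n + s n * v n"
      "\<And>n. n \<ge> N \<Longrightarrow> norm (r n) < M" "\<And>n. n \<ge> N \<Longrightarrow> norm (s n) < 1/2"
    unfolding eventually_sequentially by blast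
  \<comment> \<open>The first entry starts the induction; the second gives
    \<open>M + K/2 \<le> K\<close>, which carries it on.\<close>
  define K where "K = max (norm (v N)) (2 * M)"
  have bound: "norm (v n) \<le> K" if "n \<ge> N" for n
    using that
  proof (induction n rule: dec_induct)
    case base
    show ?case by (simp add: K_def)
  next
    case (step n)
    have "norm (v (Suc n)) \<le> norm (r n) + norm (s n) * norm (v n)"
      using N(1)[of n] step.hyps by (metis norm_mult norm_triangle_ineq)
    also have "\<dots> \<le> M + 1/2 * K"
      using N(2,3)[of n] step by (intro add_mono mult_mono) auto
    also have "\<dots> \<le> K" by (simp add: K_def)
    finally show ?case .
  qed
  have "(\<lambda>n. s n * v n) \<longlonglongrightarrow> 0"
  proof (rule Lim_null_comparison)
    show "\<forall>\<^sub>F n in sequentially. norm (s n * v n) \<le> norm (s n) * K"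
      unfolding eventually_sequentially norm_mult
      using bound by (blast intro: mult_left_mono norm_ge_zero)
    show "(\<lambda>n. norm (s n) * K) \<longlonglongrightarrow> 0"
      using tendsto_mult_right[OF tendsto_norm[OF s], of K] by simp
  qed
  from tendsto_add[OF r this] have "(\<lambda>n. r n + s n * v n) \<longlonglongrightarrow> C" by simp
  then have "(\<lambda>n. v (Suc n)) \<longlonglongrightarrow> C"
    by (rule Lim_transform_eventually) (use rec in \<open>simp add: eq_commute\<close>)
  then show ?thesis by (simp only: filterlim_sequentially_Suc)
qed

text \<open>These continuants are expanded at the outermost level, as in \<open>cf_tail\<close>.
  Since \<open>c k\<close> does not enter \<open>cf_den c d k n\<close>, numerators are continuants
  too, with start \<open>Suc k\<close>.\<close>

fun cf_den :: "(nat \<Rightarrow> complex) \<Rightarrow> (nat \<Rightarrow> complex) \<Rightarrow> nat \<Rightarrow> nat \<Rightarrow> complex" where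
  "cf_den c d k 0 = 1"
| "cf_den c d k (Suc 0) = d k"
| "cf_den c d k (Suc (Suc n)) =
     d k * cf_den c d (Suc k) (Suc n) + c (Suc k) * cf_den c d (Suc (Suc k)) n"

text \<open>The second conjunct strengthens the induction: if the inner tail is infinite, its
  numerator is nonzero, so the next denominator, then \<open>c (Suc k)\<close> times a nonzero
  continuant, does not vanish and the value is 0.\<close>

lemma cf_tail_Suc_eq:
  assumes c: "\<And>n. c n \<noteq> 0"
  shows "cf_tail c d k (Suc n) =
      (if cf_den c d k (Suc n) = 0 then None
       else Some (c k * cf_den c d (Suc k) n / cf_den c d k (Suc n)))
    \<and> (cf_den c d k (Suc n) = 0 \<longrightarrow> cf_den c d (Suc k) n \<noteq> 0)"
proof (induction n arbitrary: k)
  case 0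
  show ?case by (simp add: cf_step_def)
next
  case (Suc n)
  show ?case
  proof (cases "cf_den c d (Suc k) (Suc n) = 0")
    case True
    then show ?thesis
      using Suc.IH[of "Suc k"] c
      by (simp add: cf_step_def del: cf_tail.simps(2) add: cf_tail.simps(2)[of c d k "Suc n"])
  next
    case False
    \<comment> \<open>A common denominator shows that \<open>cf_step\<close> hits infinity exactly
      when the new continuant vanishes.\<close>
    have "d k + c (Suc k) * cf_den c d (Suc (Suc k)) n / cf_den c d (Suc k) (Suc n)
        = cf_den c d k (Suc (Suc n)) / cf_den c d (Suc k) (Suc n)"
      using False by (simp add: field_simps)
    then show ?thesis
      using Suc.IH[of "Suc k"] False
      by (simp add: cf_step_def del: cf_tail.simps(2) cf_den.simps
            add: cf_tail.simps(2)[of c d k "Suc n"])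
  qed
qed

text \<open>Repeated substitution of the recurrence into itself produces continuants as
  coefficients. As these are peeled from the front, the induction has two predecessors and varies
  \<open>k\<close>.\<close>

lemma cf_den_expansion:
  assumes "\<And>k. h k = d k * h (Suc k) + c (Suc k) * h (Suc (Suc k))"
  shows "h k = cf_den c d k (Suc n) * h (k + Suc n)
             + cf_den c d k n * c (k + Suc n) * h (Suc (k + Suc n))"
proof (induction n arbitrary: k rule: induct_nat_012)
  case 0
  show ?case using assms[of k] by simp
next
  case 1
  show ?case
    using assms[of k] assms[of "Suc k"] by (simp add: algebra_simps)
next
  case (ge2 n)
  show ?case
    using assms[of k] ge2(1)[of "Suc (Suc k)"] ge2(2)[of "Suc k"]
    by (simp add: algebra_simps)
qed

text \<open>Solving the expansion of \<open>H k\<close> for the normalised denominator gives an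
  affine recurrence in \<open>n\<close>, whose linear coefficient vanishes in the limit because
  \<open>c\<close> does and \<open>H\<close> tends to 1.\<close>

lemma cf_den_asymptotics:
  assumes rec: "\<And>k. z * H k = d k * H (Suc k) + c (Suc k) / z * H (Suc (Suc k))"
    and z: "z \<noteq> 0" and c: "c \<longlonglongrightarrow> 0" and H: "H \<longlonglongrightarrow> 1"
  shows "(\<lambda>n. cf_den c d k n / z ^ n) \<longlonglongrightarrow> H k"
proof (rule tendsto_affine_recurrence)
  let ?s = "\<lambda>n. - (c (k + Suc n) / z\<^sup>2 * H (Suc (k + Suc n))) / H (k + Suc n)"
  have shift: "(\<lambda>n. f (k + Suc n)) \<longlonglongrightarrow> l" if "f \<longlonglongrightarrow> l" for f :: "nat \<Rightarrow> complex" and l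
    using LIMSEQ_ignore_initial_segment[OF that, of "Suc k"] by (simp add: add.commute)
  have H1: "(\<lambda>n. H (k + Suc n)) \<longlonglongrightarrow> 1" by (rule shift[OF H])
  have H2: "(\<lambda>n. H (Suc (k + Suc n))) \<longlonglongrightarrow> 1"
    by (rule shift) (use H in \<open>simp only: filterlim_sequentially_Suc\<close>)
  show "(\<lambda>n. H k / H (k + Suc n)) \<longlonglongrightarrow> H k"
    using tendsto_divide[OF tendsto_const H1, of "H k"] by simp
  have "?s \<longlonglongrightarrow> - (0 / z\<^sup>2 * 1) / 1"
    by (intro tendsto_intros H1 H2 shift[OF c]) (use z in auto)
  then show "?s \<longlonglongrightarrow> 0" by simp
  have "\<forall>\<^sub>F n in sequentially. H (k + Suc n) \<noteq> 0"
    using tendsto_imp_eventually_ne[OF H1, of 0] by simp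
  then show "\<forall>\<^sub>F n in sequentially. cf_den c d k (Suc n) / z ^ Suc n
      = H k / H (k + Suc n) + ?s n * (cf_den c d k n / z ^ n)"
  proof eventually_elim
    case (elim n)
    \<comment> \<open>Dividing by \<open>z ^ j\<close> absorbs the factors \<open>z\<close> and
      \<open>1 / z\<close>, leaving the recurrence of the continuants.\<close>
    have "H j / z ^ j = d j * (H (Suc j) / z ^ Suc j)
        + c (Suc j) * (H (Suc (Suc j)) / z ^ Suc (Suc j))" for j
      using rec[of j] z by (simp add: field_simps)
    from cf_den_expansion[where h = "\<lambda>j. H j / z ^ j", OF this, of k n]
    have "H k = cf_den c d k (Suc n) / z ^ Suc n * H (k + Suc n)
        + cf_den c d k n / z ^ n * (c (k + Suc n) / z\<^sup>2 * H (Suc (k + Suc n)))"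
      using z by (simp add: field_simps power_add power2_eq_square)
    then show ?case
      using elim by (simp add: divide_simps)
  qed
qed

text \<open>As \<open>H 0 \<noteq> 0\<close>, the denominators are eventually nonzero and the
  approximants finite. The numerator continuant has one level fewer than the denominator, which
  leaves the factor \<open>1 / z\<close>.\<close>

lemma cf_has_value_of_solution:
  assumes rec: "\<And>k. z * H k = d k * H (Suc k) + c (Suc k) / z * H (Suc (Suc k))"
    and z: "z \<noteq> 0" and c: "c \<longlonglongrightarrow> 0" and H: "H \<longlonglongrightarrow> 1"
    and c_nz: "\<And>n. c n \<noteq> 0" and H0: "H 0 \<noteq> 0"
  shows "cf_has_value c d (c 0 / z * (H (Suc 0) / H 0))"
proof -
  have lim: "(\<lambda>n. cf_den c d k n / z ^ n) \<longlonglongrightarrow> H k" for k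
    by (rule cf_den_asymptotics[OF rec z c H])
  let ?v = "\<lambda>n. c 0 * cf_den c d (Suc 0) (n - 1) / cf_den c d 0 n"
  have "\<forall>\<^sub>F n in sequentially. cf_den c d 0 n / z ^ n \<noteq> 0"
    using tendsto_imp_eventually_ne[OF lim H0] .
  moreover have "\<forall>\<^sub>F n in sequentially. n > (0::nat)" by (rule eventually_gt_at_top)
  ultimately have ev: "\<forall>\<^sub>F n in sequentially. cf_tail c d 0 n = Some (?v n)"
  proof eventually_elim
    case (elim n)
    then obtain m where "n = Suc m" by (cases n) auto
    with elim cf_tail_Suc_eq[of c d 0 m] c_nz show ?case
      by (auto simp del: cf_tail.simps cf_den.simps)
  qed
  have "(\<lambda>n. c 0 / z * ((cf_den c d (Suc 0) n / z ^ n) / (cf_den c d 0 (Suc n) / z ^ Suc n)))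
      \<longlonglongrightarrow> c 0 / z * (H (Suc 0) / H 0)"
    by (intro tendsto_intros lim LIMSEQ_Suc[OF lim[of 0]] H0)
  moreover have "c 0 / z * ((cf_den c d (Suc 0) n / z ^ n) / (cf_den c d 0 (Suc n) / z ^ Suc n))
      = ?v (Suc n)" for n
    using z by (simp add: field_simps del: cf_den.simps)
  ultimately have "(\<lambda>n. ?v (Suc n)) \<longlonglongrightarrow> c 0 / z * (H (Suc 0) / H 0)" by simp
  then have "?v \<longlonglongrightarrow> c 0 / z * (H (Suc 0) / H 0)" by (rule LIMSEQ_imp_Suc)
  with ev show ?thesis unfolding cf_has_value_def by (intro exI[of _ ?v] conjI)
qed

section \<open>The Rogers--Ramanujan series\<close>

definition rr_coeff :: "complex \<Rightarrow> nat \<Rightarrow> complex" where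
  "rr_coeff q n = q ^ (n\<^sup>2) / q_poch q n"

text \<open>At \<open>w = 1\<close> and \<open>w = q\<close> this gives the two Rogers-Ramanujan
  sums.\<close>

definition rr_series :: "complex \<Rightarrow> complex \<Rightarrow> complex" where
  "rr_series q w = (\<Sum>n. rr_coeff q n * w ^ n)"

context
  fixes q :: complex
  assumes q1: "norm q < 1"
begin

lemma one_minus_power_nonzero: "1 - q ^ Suc n \<noteq> 0"
proof
  assume "1 - q ^ Suc n = 0"
  then have "norm q ^ Suc n = 1" by (metis eq_iff_diff_eq_0 norm_one norm_power)
  with q1 show False by (metis norm_ge_zero power_Suc_less_one less_irrefl
    zero_less_norm_iff norm_zero power_0_Suc zero_neq_one)
qed

lemma rr_coeff_Suc: "rr_coeff q (Suc n) * (1 - q ^ Suc n) = q ^ (2 * n + 1) * rr_coeff q n"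
proof -
  have "q_poch q (Suc n) = q_poch q n * (1 - q ^ Suc n)" by (simp add: q_poch_def)
  moreover have "q ^ (Suc n)\<^sup>2 = q ^ (2 * n + 1) * q ^ n\<^sup>2"
    unfolding power_add[symmetric]
    by (rule arg_cong[where f = "power q"]) (simp add: power2_eq_square)
  ultimately show ?thesis
    using one_minus_power_nonzero[of n]
    by (simp add: rr_coeff_def del: power_Suc)
qed

text \<open>The ratio of consecutive terms, \<open>q ^ (2 * n + 1) * w / (1 - q ^ Suc n)\<close>,
  tends to 0 for every \<open>w\<close>.\<close>

lemma rr_summable: "summable (\<lambda>n. rr_coeff q n * w ^ n)"
proof -
  have P: "(\<lambda>n. q ^ n) \<longlonglongrightarrow> 0" by (rule LIMSEQ_power_zero[OF q1])
  have "(\<lambda>n. q ^ n * q ^ n * q * w / (1 - q ^ Suc n)) \<longlonglongrightarrow> 0 * 0 * q * w / (1 - 0)"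
    by (intro tendsto_intros P LIMSEQ_Suc[OF P]) auto
  moreover have "q ^ (2 * n + 1) = q ^ n * q ^ n * q" for n
    by (simp add: mult_2 power_add)
  ultimately have "(\<lambda>n. q ^ (2 * n + 1) * w / (1 - q ^ Suc n)) \<longlonglongrightarrow> 0"
    by (simp del: power_Suc)
  from order_tendstoD(2)[OF tendsto_norm[OF this], of "1/2"]
  have "\<forall>\<^sub>F n in sequentially. norm (q ^ (2 * n + 1) * w / (1 - q ^ Suc n)) < 1/2" by simp
  then obtain N where N: "\<And>n. n \<ge> N \<Longrightarrow> norm (q ^ (2 * n + 1) * w / (1 - q ^ Suc n)) < 1/2"
    unfolding eventually_sequentially by blast
  show ?thesis
  proof (rule summable_ratio_test)
    show "(1/2::real) < 1" by simp
    fix n assume "n \<ge> N"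
    have "rr_coeff q (Suc n) = q ^ (2 * n + 1) * rr_coeff q n / (1 - q ^ Suc n)"
      using rr_coeff_Suc[of n] one_minus_power_nonzero[of n] by (simp add: eq_divide_eq)
    then have "rr_coeff q (Suc n) * w ^ Suc n
        = q ^ (2 * n + 1) * w / (1 - q ^ Suc n) * (rr_coeff q n * w ^ n)"
      by simp
    then have "norm (rr_coeff q (Suc n) * w ^ Suc n)
        = norm (q ^ (2 * n + 1) * w / (1 - q ^ Suc n)) * norm (rr_coeff q n * w ^ n)"
      by (simp only: norm_mult)
    also have "\<dots> \<le> 1/2 * norm (rr_coeff q n * w ^ n)"
      using N[OF \<open>n \<ge> N\<close>] by (intro mult_right_mono) auto
    finally show "norm (rr_coeff q (Suc n) * w ^ Suc n) \<le> 1/2 * norm (rr_coeff q n * w ^ n)" .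
  qed
qed

text \<open>Subtracting the series at \<open>q * w\<close> puts a factor \<open>1 - q ^ n\<close> on
  each term, cancelling the last factor of \<open>q_poch q n\<close>; an index shift leaves the
  series at \<open>q\<^sup>2 * w\<close>.\<close>

lemma rr_series_functional_equation:
  "rr_series q w = rr_series q (q * w) + q * w * rr_series q (q\<^sup>2 * w)"
proof -
  have *: "rr_coeff q (Suc n) * w ^ Suc n - rr_coeff q (Suc n) * (q * w) ^ Suc n
      = q * w * (rr_coeff q n * (q\<^sup>2 * w) ^ n)" for n
  proof -
    have "rr_coeff q (Suc n) * w ^ Suc n - rr_coeff q (Suc n) * (q * w) ^ Suc n
      = rr_coeff q (Suc n) * (1 - q ^ Suc n) * w ^ Suc n"
      by (simp add: algebra_simps power_mult_distrib)
    also have "\<dots> = q * w * (rr_coeff q n * (q\<^sup>2 * w) ^ n)"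
      unfolding rr_coeff_Suc
      by (simp add: power_mult_distrib power_mult[symmetric] power_add mult_ac)
    finally show ?thesis .
  qed
  have "rr_series q w - rr_series q (q * w)
      = (\<Sum>n. rr_coeff q n * w ^ n - rr_coeff q n * (q * w) ^ n)"
    unfolding rr_series_def by (rule suminf_diff[OF rr_summable rr_summable])
  \<comment> \<open>The terms of index 0 cancel.\<close>
  also have "\<dots> = (\<Sum>n. rr_coeff q (Suc n) * w ^ Suc n - rr_coeff q (Suc n) * (q * w) ^ Suc n)"
    using suminf_split_head[OF summable_diff[OF rr_summable[of w] rr_summable[of "q * w"]]]
    by simp
  also have "\<dots> = q * w * rr_series q (q\<^sup>2 * w)"
    unfolding * rr_series_def by (rule suminf_mult[OF rr_summable])
  finally show ?thesis by (simp add: algebra_simps)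
qed

text \<open>The functional equation at \<open>w\<close>, \<open>q * w\<close> and
  \<open>q\<^sup>2 * w\<close> allows the elimination of the values at \<open>q * w\<close> and
  \<open>q ^ 3 * w\<close>, so that arguments advance by \<open>q\<^sup>2\<close>, as the J-fraction
  coefficients require.\<close>

lemma rr_series_three_term:
  "rr_series q w = (1 + q * w + q\<^sup>2 * w) * rr_series q (q\<^sup>2 * w)
     - q ^ 5 * w\<^sup>2 * rr_series q (q ^ 4 * w)"
proof -
  note f = rr_series_functional_equation
  have 1: "rr_series q (q * w) = rr_series q (q\<^sup>2 * w) + q\<^sup>2 * w * rr_series q (q ^ 3 * w)"
    using f[of "q * w"] by (simp add: power2_eq_square power3_eq_cube mult_ac)
  have 2: "rr_series q (q ^ 3 * w)
      = rr_series q (q\<^sup>2 * w) - q ^ 3 * w * rr_series q (q ^ 4 * w)"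
    using f[of "q\<^sup>2 * w"] by (simp add: eval_nat_numeral mult_ac)
  show ?thesis
    unfolding f[of w] 1 2 by (simp add: algebra_simps eval_nat_numeral)
qed

lemma rr_series_tendsto_1:
  assumes "w \<longlonglongrightarrow> 0"
  shows "(\<lambda>n. rr_series q (w n)) \<longlonglongrightarrow> 1"
proof -
  have "isCont (rr_series q) 0"
    unfolding rr_series_def[abs_def]
    by (rule isCont_powser_converges_everywhere[OF rr_summable])
  then have "(\<lambda>n. rr_series q (w n)) \<longlonglongrightarrow> rr_series q 0"
    using assms by (rule isCont_tendsto_compose)
  moreover have "rr_series q 0 = 1"
    unfolding rr_series_def powser_zero by (simp add: rr_coeff_def q_poch_def)
  ultimately show ?thesis by simp
qed

end

section \<open>Matching the series recurrence with the J-fraction\<close>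

theorem mainTheorem10:
  fixes q z :: complex and a b :: "nat \<Rightarrow> complex"
  assumes "0 < norm q" and "norm q < 1"
    and "\<And>n. a n = - (1 + q) * q powi (2 * int n - 1)"
    and "\<And>n. n \<ge> 1 \<Longrightarrow> (b n)\<^sup>2 = q powi (4 * int n - 3)"
    and "z \<noteq> 0"
    and "(\<Sum>n. q powi ((int n)\<^sup>2 - 2 * int n) / q_poch q n * z powi (- int n)) \<noteq> 0"
  shows "J_fraction_has_value a b z
    (1 / z * ((\<Sum>n. q powi ((int n)\<^sup>2) / q_poch q n * z powi (- int n)) /
              (\<Sum>n. q powi ((int n)\<^sup>2 - 2 * int n) / q_poch q n * z powi (- int n))))"
proof -
  have q: "q \<noteq> 0" using assms(1) by simp
  note z = assms(5)
  \<comment> \<open>The factor \<open>1 / q\<^sup>2\<close> turns \<open>q ^ n\<^sup>2\<close> into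
    exponent \<open>n\<^sup>2 - 2 * n\<close>, so \<open>H 0\<close> is the denominator series and
    \<open>H 1\<close>, at argument \<open>1 / z\<close>, the numerator series.\<close>
  define y where "y = 1 / (q\<^sup>2 * z)"
  define H where "H k = rr_series q (q ^ (2 * k) * y)" for k
  define c where "c n = (if n = 0 then 1 else - (b n)\<^sup>2)" for n
  have c_Suc: "c (Suc k) = - (q ^ (4 * k + 1))" for k
  proof -
    have "(b (Suc k))\<^sup>2 = q powi int (4 * k + 1)"
      using assms(4)[of "Suc k"] by (simp add: algebra_simps)
    then show ?thesis unfolding power_int_of_nat by (simp add: c_def)
  qed
  \<comment> \<open>The exponent \<open>2 * k - 1\<close> is negative at \<open>k = 0\<close>, hence
    the quotient by \<open>q\<close>.\<close>
  have a: "a k = - (1 + q) * q ^ (2 * k) / q" for k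
    using assms(3)[of k] power_int_diff[of q "int (2 * k)" 1] q
    by (simp add: power_int_of_nat[symmetric] del: power_int_of_nat)
  have num: "(\<Sum>n. q powi ((int n)\<^sup>2) / q_poch q n * z powi (- int n)) = H (Suc 0)"
  proof -
    have "q powi ((int n)\<^sup>2) = q ^ n\<^sup>2" for n
      by (metis of_nat_power power_int_of_nat)
    moreover have "q ^ (2 * Suc 0) * y = inverse z"
      using q z by (simp add: y_def field_simps power2_eq_square)
    ultimately show ?thesis
      by (simp add: H_def rr_series_def rr_coeff_def power_int_minus power_inverse)
  qed
  have den: "(\<Sum>n. q powi ((int n)\<^sup>2 - 2 * int n) / q_poch q n * z powi (- int n)) = H 0"
  proof -
    have "q powi ((int n)\<^sup>2 - 2 * int n) = q ^ n\<^sup>2 / (q\<^sup>2) ^ n" for n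
    proof -
      have "q powi ((int n)\<^sup>2 - 2 * int n) = q powi int (n\<^sup>2) / q powi int (2 * n)"
        using q by (simp add: power_int_diff)
      then show ?thesis by (simp only: power_int_of_nat power_mult)
    qed
    then show ?thesis
      by (simp add: H_def y_def rr_series_def rr_coeff_def power_int_minus power_mult_distrib
        power_inverse divide_inverse mult_ac)
  qed
  have "cf_has_value c (\<lambda>n. z - a n) (c 0 / z * (H (Suc 0) / H 0))"
  proof (rule cf_has_value_of_solution)
    fix k
    have "H k = (1 + q * (q ^ (2 * k) * y) + q\<^sup>2 * (q ^ (2 * k) * y)) * H (Suc k)
        - q ^ 5 * (q ^ (2 * k) * y)\<^sup>2 * H (Suc (Suc k))"
      using rr_series_three_term[OF assms(2), of "q ^ (2 * k) * y"]
      by (simp add: H_def power2_eq_square eval_nat_numeral mult_ac)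
    \<comment> \<open>Since \<open>z * y = 1 / q\<^sup>2\<close>, multiplying the three-term
      relation by \<open>z\<close> yields both coefficients of the J-fraction recurrence.\<close>
    moreover have "z * (1 + q * (q ^ (2 * k) * y) + q\<^sup>2 * (q ^ (2 * k) * y)) = z - a k"
      using q z by (simp add: a y_def field_simps power2_eq_square)
    moreover have "z * (q ^ 5 * (q ^ (2 * k) * y)\<^sup>2) = - (c (Suc k) / z)"
    proof -
      have "q ^ (4 * k) = q ^ (2 * k) * q ^ (2 * k)" by (simp flip: power_add)
      then show ?thesis
        using q z by (simp add: c_Suc y_def field_simps eval_nat_numeral)
    qed
    ultimately show "z * H k = (z - a k) * H (Suc k) + c (Suc k) / z * H (Suc (Suc k))"
      by (metis (no_types, opaque_lifting) diff_minus_eq_add minus_mult_left mult.assoc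
          right_diff_distrib)
  next
    show "z \<noteq> 0" by fact
    have "(\<lambda>k. (q ^ 4) ^ k) \<longlonglongrightarrow> 0"
      by (rule LIMSEQ_power_zero) (use assms(2) in \<open>simp add: norm_power power_less_one_iff\<close>)
    from tendsto_minus[OF tendsto_mult_right[OF this, of q]]
    have "(\<lambda>k. - ((q ^ 4) ^ k * q)) \<longlonglongrightarrow> 0" by simp
    then have "(\<lambda>k. c (Suc k)) \<longlonglongrightarrow> 0" by (simp add: c_Suc power_mult mult.commute[of _ q])
    then show "c \<longlonglongrightarrow> 0" by (simp only: filterlim_sequentially_Suc)
    have "(\<lambda>k. (q\<^sup>2) ^ k) \<longlonglongrightarrow> 0"
      by (rule LIMSEQ_power_zero) (use assms(2) in \<open>simp add: norm_power power_less_one_iff\<close>)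
    then have "(\<lambda>k. q ^ (2 * k) * y) \<longlonglongrightarrow> 0"
      by (simp add: power_mult tendsto_mult_left_zero)
    then show "H \<longlonglongrightarrow> 1"
      unfolding H_def[abs_def] by (rule rr_series_tendsto_1[OF assms(2)])
    show "c n \<noteq> 0" for n
      using q c_Suc by (cases n) (auto simp: c_def)
    show "H 0 \<noteq> 0" using assms(6) den by simp
  qed
  then show ?thesis
    unfolding J_fraction_has_value_def num den by (simp add: c_def[abs_def])
qed

end
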